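(* Let $k$ be a positive integer and $n>1$ an odd integer. Then $$\prod_{d\mid n}\binom{(kd-1)/2}{(d-1)/2}^{\mu(n/d)}\equiv 2^{-(k-1)\phi(n)} \begin{cases} \pmod{n^3} & \text{if }3\nmid n,\\ \pmod{n^3/3} & \text{if }3\mid n. \end{cases}$$
   Context: $\phi$ is Euler's totient function and $\mu$ the Möbius function; the product runs over all positive divisors $d$ of $n$. For $x\in\mathbb{C}$ and a positive integer $m$, $\binom{x}{m}=\frac{x(x-1)\cdots(x-m+1)}{m!}$, and $\binom{x}{0}=1$ (so the upper argument $(kd-1)/2$ may be a half-integer). Congruences between rational numbers modulo a positive integer $M$ mean that the difference equals $M$ times a rational number whose denominator is coprime to $M$. *)

theory Defs
  imports Complex_Main "HOL-Computational_Algebra.Computational_Algebra"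
    "HOL-Number_Theory.Number_Theory"
begin

definition moebius_mu :: "nat \<Rightarrow> int" where
  "moebius_mu n = (if squarefree n then (-1) ^ card (prime_factors n) else 0)"

text \<open>Congruence of rationals: \<^term>\<open>snd (quotient_of r)\<close> is the positive denominator of
  \<^term>\<open>r\<close> in lowest terms.\<close>

definition rat_cong :: "rat \<Rightarrow> rat \<Rightarrow> nat \<Rightarrow> bool" where
  "rat_cong x y M \<longleftrightarrow>
     (\<exists>r. x - y = of_nat M * r \<and> coprime (snd (quotient_of r)) (int M))"

end

theory Submission
  imports Defs
begin

text \<open>The binomial coefficient for \<open>d = 2 h + 1\<close> equals the product of \<open>1 + (k - 1) d / (2 i)\<close> over
  \<open>1 \<le> i \<le> h\<close>. Sorting the \<open>i\<close> by \<open>gcd i d\<close> and Moebius inversion turn the left-hand side into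
  \<open>F (k - 1)\<close>, where \<open>F a\<close> is the product of \<open>1 + a n / (2 i)\<close> over the \<open>i < n / 2\<close> coprime to \<open>n\<close>.
  Since the inverse squares of these \<open>i\<close> add up to \<open>0\<close> modulo \<open>n\<close> (up to a factor \<open>3\<close>), \<open>F\<close> turns sums
  into products modulo \<open>n\<^sup>3\<close> (or \<open>n\<^sup>3 / 3\<close>). Splitting the totatives of \<open>n\<close> both as \<open>i, n - i\<close> and as
  \<open>2 i, n - 2 i\<close> gives the exact identity \<open>F (-2) = 2 ^ totient n * F (-1)\<close>, whence
  \<open>F 1 \<equiv> 2 ^ (- totient n)\<close>.\<close>

section \<open>Rationals with denominator coprime to the modulus\<close>

text \<open>The rationals that are integral at every prime dividing \<open>M\<close>; they form a
  subring, inside which congruences modulo \<open>M\<close> can be multiplied.\<close>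

definition denom_coprime :: "nat \<Rightarrow> rat \<Rightarrow> bool" where
  "denom_coprime M r \<longleftrightarrow> coprime (snd (quotient_of r)) (int M)"

lemma rat_cong_altdef: "rat_cong x y M \<longleftrightarrow> (\<exists>r. x - y = of_nat M * r \<and> denom_coprime M r)"
  by (simp add: rat_cong_def denom_coprime_def)

text \<open>Any fraction representing the number will do: its reduced denominator divides
  \<open>b\<close>.\<close>

lemma denom_coprime_divide:
  assumes "coprime b (int M)"
  shows "denom_coprime M (of_int a / of_int b)"
proof (cases "b = 0")
  case True
  then show ?thesis by (simp add: denom_coprime_def)
next
  case False
  obtain p q where pq: "quotient_of (of_int a / of_int b :: rat) = (p, q)"
    by force
  have q: "q > 0" "coprime p q" "(of_int a / of_int b :: rat) = of_int p / of_int q"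
    using quotient_of_denom_pos[OF pq] quotient_of_coprime[OF pq] quotient_of_div[OF pq] by auto
  have "(of_int (a * q) :: rat) = of_int (p * b)"
    using q False by (simp add: field_simps)
  then have "a * q = p * b" by (simp only: of_int_eq_iff)
  then have "q dvd p * b" by (metis dvd_triv_right)
  with q(2) have "q dvd b" by (simp add: coprime_commute coprime_dvd_mult_right_iff)
  with assms have "coprime q (int M)" by (meson coprime_divisors dvd_refl)
  then show ?thesis by (simp add: denom_coprime_def pq)
qed

lemma denom_coprimeE:
  assumes "denom_coprime M r"
  obtains a b where "r = of_int a / of_int b" "b > 0" "coprime b (int M)"
proof -
  obtain p q where pq: "quotient_of r = (p, q)" by force
  have "coprime q (int M)" using assms by (simp add: denom_coprime_def pq)
  then show ?thesis
    by (rule that[OF quotient_of_div[OF pq] quotient_of_denom_pos[OF pq]])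
qed

lemma denom_coprime_of_int [simp]: "denom_coprime M (of_int a)"
  using denom_coprime_divide[of 1 M a] by simp

lemma denom_coprime_numeral [simp]:
  "denom_coprime M 0" "denom_coprime M 1" "denom_coprime M (of_nat m)" "denom_coprime M (numeral w)"
  using denom_coprime_of_int[of M 0] denom_coprime_of_int[of M 1] denom_coprime_of_int[of M "int m"]
    denom_coprime_of_int[of M "numeral w"] by simp_all

lemma denom_coprime_inverse:
  "coprime m M \<Longrightarrow> denom_coprime M (1 / of_nat m)"
  using denom_coprime_divide[of "int m" M 1] by simp

lemma denom_coprime_add [simp]:
  assumes "denom_coprime M x" "denom_coprime M y"
  shows "denom_coprime M (x + y)"
proof -
  obtain a b where x: "x = of_int a / of_int b" "b > 0" "coprime b (int M)"
    using assms(1) by (rule denom_coprimeE)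
  obtain c d where y: "y = of_int c / of_int d" "d > 0" "coprime d (int M)"
    using assms(2) by (rule denom_coprimeE)
  have "x + y = of_int (a * d + c * b) / of_int (b * d)"
    using x y by (simp add: field_simps)
  then show ?thesis
    using denom_coprime_divide[of "b * d" M "a * d + c * b"] x y by simp
qed

lemma denom_coprime_mult [simp]:
  assumes "denom_coprime M x" "denom_coprime M y"
  shows "denom_coprime M (x * y)"
proof -
  obtain a b where x: "x = of_int a / of_int b" "b > 0" "coprime b (int M)"
    using assms(1) by (rule denom_coprimeE)
  obtain c d where y: "y = of_int c / of_int d" "d > 0" "coprime d (int M)"
    using assms(2) by (rule denom_coprimeE)
  show ?thesis
    using denom_coprime_divide[of "b * d" M "a * c"] x y by simp
qed

lemma denom_coprime_uminus [simp]: "denom_coprime M x \<Longrightarrow> denom_coprime M (- x)"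
  using denom_coprime_mult[OF denom_coprime_of_int[of M "-1"], of x] by simp

lemma denom_coprime_diff [simp]:
  "denom_coprime M x \<Longrightarrow> denom_coprime M y \<Longrightarrow> denom_coprime M (x - y)"
  using denom_coprime_add[of M x "- y"] by simp

lemma denom_coprime_power [simp]: "denom_coprime M x \<Longrightarrow> denom_coprime M (x ^ m)"
  by (induction m) simp_all

lemma denom_coprime_sum:
  "(\<And>i. i \<in> S \<Longrightarrow> denom_coprime M (f i)) \<Longrightarrow> denom_coprime M (sum f S)"
  by (induction S rule: infinite_finite_induct) simp_all

lemma denom_coprime_prod:
  "(\<And>i. i \<in> S \<Longrightarrow> denom_coprime M (f i)) \<Longrightarrow> denom_coprime M (prod f S)"
  by (induction S rule: infinite_finite_induct) simp_all

section \<open>Calculus of congruences between rationals\<close>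

lemma rat_congI: "x - y = of_nat M * r \<Longrightarrow> denom_coprime M r \<Longrightarrow> rat_cong x y M"
  by (auto simp: rat_cong_altdef)

lemma rat_cong_refl [simp]: "rat_cong x x M"
  by (rule rat_congI[of _ _ _ 0]) simp_all

lemma rat_cong_sym: "rat_cong x y M \<Longrightarrow> rat_cong y x M"
proof -
  assume "rat_cong x y M"
  then obtain r where "x - y = of_nat M * r" "denom_coprime M r"
    by (auto simp: rat_cong_altdef)
  then show ?thesis by (intro rat_congI[of _ _ _ "- r"]) simp_all
qed

lemma rat_cong_trans [trans]:
  assumes "rat_cong x y M" "rat_cong y z M"
  shows "rat_cong x z M"
proof -
  obtain r s where "x - y = of_nat M * r" "denom_coprime M r"
    "y - z = of_nat M * s" "denom_coprime M s"
    using assms by (auto simp: rat_cong_altdef)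
  then show ?thesis by (intro rat_congI[of _ _ _ "r + s"]) (simp_all add: algebra_simps)
qed

text \<open>Congruent rationals may share a denominator not coprime to \<open>M\<close>, so
  integrality is assumed for the cofactors in \<open>(x - y) * x' + y * (x' - y')\<close>.\<close>

lemma rat_cong_mult:
  assumes "rat_cong x y M" "rat_cong x' y' M" "denom_coprime M x'" "denom_coprime M y"
  shows "rat_cong (x * x') (y * y') M"
proof -
  obtain r s where "x - y = of_nat M * r" "denom_coprime M r"
    "x' - y' = of_nat M * s" "denom_coprime M s"
    using assms by (auto simp: rat_cong_altdef)
  moreover have "x * x' - y * y' = (x - y) * x' + y * (x' - y')" by (simp add: algebra_simps)
  ultimately have "x * x' - y * y' = of_nat M * (r * x' + y * s)"
    by (simp add: algebra_simps)
  then show ?thesis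
    by (rule rat_congI) (use assms(3,4) \<open>denom_coprime M r\<close> \<open>denom_coprime M s\<close> in simp)
qed

lemma rat_cong_prod:
  assumes "\<And>i. i \<in> S \<Longrightarrow> rat_cong (f i) (g i) M"
    and "\<And>i. i \<in> S \<Longrightarrow> denom_coprime M (f i)" "\<And>i. i \<in> S \<Longrightarrow> denom_coprime M (g i)"
  shows "rat_cong (prod f S) (prod g S) M"
  using assms
  by (induction S rule: infinite_finite_induct) (auto intro!: rat_cong_mult denom_coprime_prod)

text \<open>In the expanded product every term beyond the linear ones carries
  \<open>c\<^sup>2\<close>, a multiple of \<open>M\<close>.\<close>

lemma rat_cong_prod_one_plus:
  fixes c :: nat
  assumes "M dvd c\<^sup>2" "\<And>i. i \<in> S \<Longrightarrow> denom_coprime M (y i)"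
  shows "rat_cong (\<Prod>i\<in>S. 1 + of_nat c * y i) (1 + of_nat c * sum y S) M"
  using assms(2)
proof (induction S rule: infinite_finite_induct)
  case (insert j S)
  obtain t where t: "c\<^sup>2 = M * t" using assms(1) by blast
  have c: "(of_nat c :: rat) * of_nat c = of_nat M * of_nat t"
    using t by (simp add: power2_eq_square flip: of_nat_mult)
  have "rat_cong (\<Prod>i\<in>insert j S. 1 + of_nat c * y i)
      ((1 + of_nat c * y j) * (1 + of_nat c * sum y S)) M"
    using insert by (auto intro!: rat_cong_mult denom_coprime_prod)
  also have "rat_cong ((1 + of_nat c * y j) * (1 + of_nat c * sum y S)) (1 + of_nat c * sum y (insert j S)) M"
  proof (rule rat_congI)
    have "(1 + of_nat c * y j) * (1 + of_nat c * sum y S) - (1 + of_nat c * sum y (insert j S))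
        = (of_nat c * of_nat c) * (y j * sum y S)"
      using insert by (simp add: algebra_simps)
    then show "(1 + of_nat c * y j) * (1 + of_nat c * sum y S) - (1 + of_nat c * sum y (insert j S))
        = of_nat M * (of_nat t * (y j * sum y S))"
      by (simp add: c)
    show "denom_coprime M (of_nat t * (y j * sum y S))"
      using insert by (simp add: denom_coprime_sum)
  qed
  finally show ?case .
qed simp_all

section \<open>Totatives below half the modulus\<close>

definition half_totatives :: "nat \<Rightarrow> nat set" where
  "half_totatives n = {i. 0 < i \<and> 2 * i < n \<and> coprime i n}"

lemma finite_half_totatives [simp]: "finite (half_totatives n)"
  by (rule finite_subset[of _ "{..n}"]) (auto simp: half_totatives_def)

lemma coprime_diff_self_iff:
  fixes i n :: nat
  assumes "i < n"
  shows "coprime (n - i) n \<longleftrightarrow> coprime i n"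
  unfolding coprime_iff_gcd_eq_1 using gcd_diff2_nat[of i n] assms by simp

text \<open>For odd \<open>n\<close> the reflection \<open>i\<close> to \<open>n - i\<close> has no
  fixed point. Removing \<open>n\<close> only matters for \<open>n = 1\<close>, where
  \<open>totatives 1 = {1}\<close> but \<open>half_totatives 1\<close> is empty.\<close>

lemma totatives_split_half:
  assumes "odd n"
  shows "totatives n - {n} = half_totatives n \<union> (\<lambda>i. n - i) ` half_totatives n"
    and "half_totatives n \<inter> (\<lambda>i. n - i) ` half_totatives n = {}"
proof -
  show "totatives n - {n} = half_totatives n \<union> (\<lambda>i. n - i) ` half_totatives n"
  proof (intro equalityI subsetI)
    fix x assume "x \<in> totatives n - {n}"
    then have x: "0 < x" "x < n" "coprime x n" by (auto simp: totatives_def)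
    show "x \<in> half_totatives n \<union> (\<lambda>i. n - i) ` half_totatives n"
    proof (cases "2 * x < n")
      case True
      with x show ?thesis by (simp add: half_totatives_def)
    next
      case False
      with assms have "n < 2 * x" by (cases "n = 2 * x") auto
      with x have "n - x \<in> half_totatives n" by (simp add: half_totatives_def coprime_diff_self_iff)
      with x show ?thesis by (intro UnI2 image_eqI[of _ _ "n - x"]) auto
    qed
  next
    fix x assume "x \<in> half_totatives n \<union> (\<lambda>i. n - i) ` half_totatives n"
    then obtain i where "i \<in> half_totatives n" "x = i \<or> x = n - i" by blast
    then show "x \<in> totatives n - {n}"
      using coprime_diff_self_iff[of i n] by (auto simp: totatives_def half_totatives_def)
  qed
  show "half_totatives n \<inter> (\<lambda>i. n - i) ` half_totatives n = {}"
    by (auto simp: half_totatives_def)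
qed

text \<open>This sorts by parity: an even totative is \<open>2 * i\<close>, and an odd one becomes
  even under reflection because \<open>n\<close> is odd.\<close>

lemma totatives_split_double:
  assumes "odd n"
  shows "totatives n - {n} = (\<lambda>i. 2 * i) ` half_totatives n \<union> (\<lambda>i. n - 2 * i) ` half_totatives n"
    and "(\<lambda>i. 2 * i) ` half_totatives n \<inter> (\<lambda>i. n - 2 * i) ` half_totatives n = {}"
proof -
  show "totatives n - {n} = (\<lambda>i. 2 * i) ` half_totatives n \<union> (\<lambda>i. n - 2 * i) ` half_totatives n"
  proof (intro equalityI subsetI)
    fix x assume "x \<in> totatives n - {n}"
    then have x: "0 < x" "x < n" "coprime x n" by (auto simp: totatives_def)
    show "x \<in> (\<lambda>i. 2 * i) ` half_totatives n \<union> (\<lambda>i. n - 2 * i) ` half_totatives n"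
    proof (cases "even x")
      case True
      with x show ?thesis
        by (intro UnI1 image_eqI[of _ _ "x div 2"]) (auto simp: half_totatives_def elim!: evenE)
    next
      case False
      with assms have "even (n - x)" by simp
      then obtain y where y: "n - x = 2 * y" by blast
      have "coprime (2 * y) n" using coprime_diff_self_iff[OF x(2)] x(3) unfolding y by simp
      with x y have "y \<in> half_totatives n" by (auto simp: half_totatives_def)
      with y x show ?thesis by (intro UnI2 image_eqI[of _ _ y]) auto
    qed
  next
    fix x assume "x \<in> (\<lambda>i. 2 * i) ` half_totatives n \<union> (\<lambda>i. n - 2 * i) ` half_totatives n"
    then obtain i where "i \<in> half_totatives n" "x = 2 * i \<or> x = n - 2 * i" by blast
    then show "x \<in> totatives n - {n}"
      using assms coprime_diff_self_iff[of "2 * i" n]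
      by (auto simp: totatives_def half_totatives_def)
  qed
  have "odd (n - 2 * j)" if "j \<in> half_totatives n" for j
    using assms that by (simp add: half_totatives_def)
  then have "2 * i \<noteq> n - 2 * j" if "j \<in> half_totatives n" for i j
    using that dvd_triv_left[of 2 i] by metis
  then show "(\<lambda>i. 2 * i) ` half_totatives n \<inter> (\<lambda>i. n - 2 * i) ` half_totatives n = {}"
    by (auto simp: disjoint_iff)
qed

context comm_monoid_set
begin

text \<open>Working in \<open>comm_monoid_set\<close> yields both a sum version (counting, inverse
  squares) and a product version (for \<open>half_prod_minus_two\<close>).\<close>

lemma totatives_half:
  assumes "odd n"
  shows "F g (totatives n - {n}) = F (\<lambda>i. g i \<^bold>* g (n - i)) (half_totatives n)"
proof -
  have "inj_on (\<lambda>i. n - i) (half_totatives n)"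
    by (auto simp: inj_on_def half_totatives_def)
  then have "F g ((\<lambda>i. n - i) ` half_totatives n) = F (\<lambda>i. g (n - i)) (half_totatives n)"
    by (simp add: reindex o_def)
  then show ?thesis
    using totatives_split_half[OF assms] by (simp add: union_disjoint distrib)
qed

lemma totatives_double:
  assumes "odd n"
  shows "F g (totatives n - {n}) = F (\<lambda>i. g (2 * i) \<^bold>* g (n - 2 * i)) (half_totatives n)"
proof -
  have "inj_on (\<lambda>i. n - 2 * i) (half_totatives n)" "inj_on (\<lambda>i::nat. 2 * i) (half_totatives n)"
    by (auto simp: inj_on_def half_totatives_def)
  then have "F g ((\<lambda>i. n - 2 * i) ` half_totatives n) = F (\<lambda>i. g (n - 2 * i)) (half_totatives n)"
    "F g ((\<lambda>i. 2 * i) ` half_totatives n) = F (\<lambda>i. g (2 * i)) (half_totatives n)"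
    by (simp_all add: reindex o_def)
  then show ?thesis
    using totatives_split_double[OF assms] by (simp add: union_disjoint distrib)
qed

end

lemma totient_eq_card_half:
  assumes "odd n" "n > 1"
  shows "totient n = 2 * card (half_totatives n)"
proof -
  have "n \<notin> totatives n" using assms by (simp add: totatives_def)
  then show ?thesis
    using sum.totatives_half[OF assms(1), of "\<lambda>_. 1 :: nat"] by (simp add: totient_def)
qed


section \<open>Products of linear factors over half the totatives\<close>

definition half_prod :: "nat \<Rightarrow> int \<Rightarrow> rat" where
  "half_prod n a = (\<Prod>i\<in>half_totatives n. 1 + of_int a * of_nat n / (2 * of_nat i))"

definition cube_modulus :: "nat \<Rightarrow> nat" where
  "cube_modulus n = (if 3 dvd n then n ^ 3 div 3 else n ^ 3)"

lemma cube_modulus_dvd_cube: "cube_modulus n dvd n ^ 3"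
proof (cases "3 dvd n")
  case True
  then obtain t where "n = 3 * t" by blast
  then show ?thesis by (simp add: cube_modulus_def power_mult_distrib)
qed (simp add: cube_modulus_def)

text \<open>The modulus has the same prime factors as \<open>n\<close>: for \<open>n = 3 * t\<close>
  it equals \<open>n\<^sup>2 * t\<close>, which \<open>n\<close> still divides.\<close>

lemma denom_coprime_cube_modulus [simp]:
  "denom_coprime (cube_modulus n) r \<longleftrightarrow> denom_coprime n r"
proof (cases "3 dvd n")
  case True
  then obtain t where t: "n = 3 * t" by blast
  then have "cube_modulus n = n\<^sup>2 * t"
    by (simp add: cube_modulus_def power2_eq_square power3_eq_cube)
  moreover have "coprime x (int t)" if "coprime x (int n)" for x
    using that t by simp
  ultimately show ?thesis
    by (auto simp: denom_coprime_def)
qed (simp add: cube_modulus_def denom_coprime_def)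

section \<open>Inverse squares of totatives modulo \<open>n\<close>\<close>

lemma inverse_square_reflect:
  assumes "0 < j" "j < n" "coprime j n"
  shows "\<exists>r. (1 / of_nat (n - j))\<^sup>2 = (1 / of_nat j)\<^sup>2 + of_nat n * r \<and> denom_coprime n r"
proof (intro exI conjI)
  let ?x = "1 / of_nat j :: rat" and ?y = "1 / of_nat (n - j) :: rat"
  have "coprime (n - j) n" using assms coprime_diff_self_iff by blast
  \<comment> \<open>The witness comes from
    \<open>j\<^sup>2 - (n - j)\<^sup>2 = n * (2 * j - n)\<close>, divided by
    \<open>j\<^sup>2 * (n - j)\<^sup>2\<close>.\<close>
  then show "denom_coprime n ((2 * of_nat j - of_nat n) * ?x\<^sup>2 * ?y\<^sup>2)"
    using assms by (intro denom_coprime_mult denom_coprime_diff denom_coprime_power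
        denom_coprime_inverse) simp_all
  have [simp]: "of_nat (n - j) = (of_nat n - of_nat j :: rat)" using assms by (simp add: of_nat_diff)
  have "of_nat n - of_nat j \<noteq> (0 :: rat)" "of_nat j \<noteq> (0 :: rat)" using assms by auto
  then show "?y\<^sup>2 = ?x\<^sup>2 + of_nat n * ((2 * of_nat j - of_nat n) * ?x\<^sup>2 * ?y\<^sup>2)"
    by (simp add: divide_simps) (simp add: algebra_simps power2_eq_square)
qed

text \<open>Doubling permutes the totatives modulo \<open>n\<close>, so \<open>S = 4 S\<close> modulo \<open>n\<close> for the sum \<open>S\<close> of
  their inverse squares; this is where the factor \<open>3\<close> comes from.\<close>

lemma three_sum_inverse_squares:
  assumes "odd n"
  obtains r where "3 * (\<Sum>i\<in>half_totatives n. (1 / of_nat i)\<^sup>2) = of_nat n * r" "denom_coprime n r"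
proof -
  let ?H = "half_totatives n"
  define f :: "nat \<Rightarrow> rat" where "f i = (1 / of_nat i)\<^sup>2" for i
  have "\<forall>j. \<exists>r. 0 < j \<and> j < n \<and> coprime j n \<longrightarrow>
      f (n - j) = f j + of_nat n * r \<and> denom_coprime n r"
    using inverse_square_reflect unfolding f_def by simp
  from choice[OF this] obtain r where r: "f (n - j) = f j + of_nat n * r j" "denom_coprime n (r j)"
    if "0 < j" "j < n" "coprime j n" for j by blast
  have r1: "f (n - i) = f i + of_nat n * r i" "denom_coprime n (r i)" if "i \<in> ?H" for i
    using that by (auto intro!: r simp: half_totatives_def)
  have r2: "f (n - 2 * i) = f (2 * i) + of_nat n * r (2 * i)" "denom_coprime n (r (2 * i))"
    if "i \<in> ?H" for i
    using that assms by (auto intro!: r simp: half_totatives_def)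
  have f2: "f (2 * i) = f i / 4" for i by (simp add: f_def power2_eq_square)
  \<comment> \<open>The total of \<open>f\<close> over the totatives below \<open>n\<close> is
    evaluated by both splittings; modulo \<open>n\<close> it is \<open>2 * S\<close> and also
    \<open>S / 2\<close>, where \<open>S = sum f ?H\<close>.\<close>
  have "(\<Sum>i\<in>?H. 2 * f i + of_nat n * r i) = (\<Sum>i\<in>?H. f i + f (n - i))"
    by (intro sum.cong) (simp_all add: r1)
  also have "\<dots> = (\<Sum>i\<in>?H. f (2 * i) + f (n - 2 * i))"
    using sum.totatives_half[OF assms, of f] sum.totatives_double[OF assms, of f] by simp
  also have "\<dots> = (\<Sum>i\<in>?H. f i / 2 + of_nat n * r (2 * i))"
    by (intro sum.cong) (simp_all add: r2 f2)
  finally have "2 * sum f ?H + of_nat n * (\<Sum>i\<in>?H. r i)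
      = sum f ?H / 2 + of_nat n * (\<Sum>i\<in>?H. r (2 * i))"
    by (simp add: sum.distrib sum_distrib_left sum_divide_distrib)
  then have "3 * sum f ?H = of_nat n * (2 * ((\<Sum>i\<in>?H. r (2 * i)) - (\<Sum>i\<in>?H. r i)))"
    by (simp add: algebra_simps)
  moreover have "denom_coprime n (2 * ((\<Sum>i\<in>?H. r (2 * i)) - (\<Sum>i\<in>?H. r i)))"
    using r1 r2 by (intro denom_coprime_mult denom_coprime_diff denom_coprime_sum) simp_all
  ultimately show ?thesis using that unfolding f_def by blast
qed

text \<open>Three times the sum is a multiple of \<open>n\<close>. If 3 is coprime to
  \<open>n\<close> it can be inverted; otherwise \<open>n = 3 * t\<close> and only the factor
  \<open>t\<close> remains, giving \<open>n\<^sup>2 * t = cube_modulus n\<close>.\<close>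

lemma square_times_sum_inverse_squares:
  assumes "odd n"
  obtains r where "(of_nat n)\<^sup>2 * (\<Sum>i\<in>half_totatives n. (1 / of_nat i)\<^sup>2) = of_nat (cube_modulus n) * r"
    "denom_coprime n r"
proof -
  let ?p = "\<Sum>i\<in>half_totatives n. (1 / of_nat i)\<^sup>2 :: rat"
  obtain r where r: "3 * ?p = of_nat n * r" "denom_coprime n r"
    using three_sum_inverse_squares[OF assms] .
  show ?thesis
  proof (cases "3 dvd n")
    case True
    then obtain t where t: "n = 3 * t" by blast
    then have "cube_modulus n = n\<^sup>2 * t"
      by (simp add: cube_modulus_def power2_eq_square power3_eq_cube)
    moreover have "?p = of_nat t * r" using r t by simp
    ultimately show ?thesis using r that[of r] by simp
  next
    case False
    then have "coprime 3 n"
      by (simp add: prime_imp_coprime)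
    then have "denom_coprime n (r * (1 / of_nat 3))"
      using r by (intro denom_coprime_mult denom_coprime_inverse)
    moreover have "?p = of_nat n * (r * (1 / of_nat 3))" using r by simp
    ultimately show ?thesis using False that[of "r * (1 / of_nat 3)"]
      by (simp add: cube_modulus_def power2_eq_square power3_eq_cube)
  qed
qed

section \<open>Multiplicativity of \<open>half_prod\<close> in its parameter\<close>

lemma denom_coprime_half_term:
  assumes "odd n" "i \<in> half_totatives n"
  shows "denom_coprime n (1 / (2 * of_nat i))"
  using denom_coprime_inverse[of "2 * i" n] assms by (simp add: half_totatives_def)

lemma denom_coprime_half_prod:
  assumes "odd n"
  shows "denom_coprime n (half_prod n a)"
  unfolding half_prod_def
proof (intro denom_coprime_prod denom_coprime_add)
  fix i assume "i \<in> half_totatives n"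
  from denom_coprime_half_term[OF assms this]
  have "denom_coprime n (of_int a * of_nat n * (1 / (2 * of_nat i)))"
    by (intro denom_coprime_mult) simp_all
  then show "denom_coprime n (of_int a * of_nat n / (2 * of_nat i))" by simp
qed simp

text \<open>With \<open>x = 1 / (2 * i)\<close>, the factors satisfy \<open>(1 + a n x) (1 + b n x)
  \<equiv> (1 + (a + b) n x) (1 + a b n\<^sup>2 x\<^sup>2)\<close> modulo \<open>n\<^sup>3\<close>.
  The product of the correction factors is 1 modulo \<open>cube_modulus n\<close> by the result on
  inverse squares.\<close>

lemma half_prod_add:
  assumes "odd n"
  shows "rat_cong (half_prod n a * half_prod n b) (half_prod n (a + b)) (cube_modulus n)"
proof -
  let ?H = "half_totatives n" and ?M = "cube_modulus n"
  define x :: "nat \<Rightarrow> rat" where "x i = 1 / (2 * of_nat i)" for i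
  have x: "denom_coprime n (x i)" if "i \<in> ?H" for i
    using denom_coprime_half_term[OF assms that] by (simp add: x_def)
  define y where "y i = of_int (a * b) * (x i)\<^sup>2" for i
  have y: "denom_coprime n (y i)" if "i \<in> ?H" for i
    using x[OF that] by (simp add: y_def del: of_int_mult)
  have hp: "half_prod n c = (\<Prod>i\<in>?H. 1 + of_int c * of_nat n * x i)" for c
    by (simp add: half_prod_def x_def)
  obtain s where s: "n ^ 3 = ?M * s" using cube_modulus_dvd_cube by blast
  then have s': "(of_nat n :: rat) ^ 3 = of_nat ?M * of_nat s" by (metis of_nat_mult of_nat_power)
  have "half_prod n a * half_prod n b
      = (\<Prod>i\<in>?H. (1 + of_int a * of_nat n * x i) * (1 + of_int b * of_nat n * x i))"
    by (simp add: hp prod.distrib)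
  also have "rat_cong \<dots>
      (\<Prod>i\<in>?H. (1 + of_int (a + b) * of_nat n * x i) * (1 + of_nat (n\<^sup>2) * y i)) ?M"
  proof (rule rat_cong_prod)
    fix i assume i: "i \<in> ?H"
    show "rat_cong ((1 + of_int a * of_nat n * x i) * (1 + of_int b * of_nat n * x i))
        ((1 + of_int (a + b) * of_nat n * x i) * (1 + of_nat (n\<^sup>2) * y i)) ?M"
    proof (rule rat_congI)
      have "(1 + of_int a * of_nat n * x i) * (1 + of_int b * of_nat n * x i)
          - (1 + of_int (a + b) * of_nat n * x i) * (1 + of_nat (n\<^sup>2) * y i)
          = of_nat n ^ 3 * (- of_int ((a + b) * (a * b)) * x i ^ 3)"
        by (simp add: y_def algebra_simps power2_eq_square power3_eq_cube)
      then show "(1 + of_int a * of_nat n * x i) * (1 + of_int b * of_nat n * x i)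
          - (1 + of_int (a + b) * of_nat n * x i) * (1 + of_nat (n\<^sup>2) * y i)
          = of_nat ?M * (of_nat s * (- of_int ((a + b) * (a * b)) * x i ^ 3))"
        by (simp add: s')
      show "denom_coprime ?M (of_nat s * (- of_int ((a + b) * (a * b)) * x i ^ 3))"
        using x[OF i] by (simp del: of_int_mult of_int_add)
    qed
  qed (use x y in \<open>simp_all del: of_int_add of_nat_power\<close>)
  also have "(\<Prod>i\<in>?H. (1 + of_int (a + b) * of_nat n * x i) * (1 + of_nat (n\<^sup>2) * y i))
      = half_prod n (a + b) * (\<Prod>i\<in>?H. 1 + of_nat (n\<^sup>2) * y i)"
    by (simp add: hp prod.distrib)
  also have "rat_cong (half_prod n (a + b) * (\<Prod>i\<in>?H. 1 + of_nat (n\<^sup>2) * y i))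
      (half_prod n (a + b) * 1) ?M"
  proof (rule rat_cong_mult[OF rat_cong_refl])
    \<comment> \<open>The modulus divides \<open>n ^ 3\<close>, hence \<open>n ^ 4\<close>, so the
      product linearises with \<open>c = n\<^sup>2\<close>.\<close>
    have "?M dvd (n\<^sup>2)\<^sup>2"
      using cube_modulus_dvd_cube[of n] le_imp_power_dvd[of 3 4 n] dvd_trans
      by (simp flip: power_mult) blast
    then have "rat_cong (\<Prod>i\<in>?H. 1 + of_nat (n\<^sup>2) * y i) (1 + of_nat (n\<^sup>2) * sum y ?H) ?M"
      using y by (intro rat_cong_prod_one_plus) simp_all
    also have "rat_cong (1 + of_nat (n\<^sup>2) * sum y ?H) 1 ?M"
    proof -
      obtain r where r: "(of_nat n)\<^sup>2 * (\<Sum>i\<in>?H. (1 / of_nat i)\<^sup>2) = of_nat ?M * r"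
        "denom_coprime n r"
        using square_times_sum_inverse_squares[OF assms] .
      have "sum y ?H = of_int (a * b) * (1 / of_nat 4) * (\<Sum>i\<in>?H. (1 / of_nat i)\<^sup>2)"
        unfolding sum_distrib_left by (intro sum.cong) (simp_all add: y_def x_def power2_eq_square)
      then have "1 + of_nat (n\<^sup>2) * sum y ?H - 1
          = of_int (a * b) * (1 / of_nat 4) * ((of_nat n)\<^sup>2 * (\<Sum>i\<in>?H. (1 / of_nat i)\<^sup>2))"
        by (simp add: mult_ac)
      also have "\<dots> = of_nat ?M * (of_int (a * b) * (1 / of_nat 4) * r)"
        unfolding r(1) by (simp add: mult_ac)
      finally show ?thesis
      proof (rule rat_congI)
        \<comment> \<open>The 4 stems from squaring \<open>x i = 1 / (2 * i)\<close>; it is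
          invertible since \<open>n\<close> is odd.\<close>
        have "coprime (2 ^ 2) n"
          using assms by (subst coprime_power_left_iff) simp
        then have "coprime 4 n" by simp
        then show "denom_coprime ?M (of_int (a * b) * (1 / of_nat 4) * r)"
          unfolding denom_coprime_cube_modulus
          by (intro denom_coprime_mult denom_coprime_inverse denom_coprime_of_int r)
      qed
    qed
    finally show "rat_cong (\<Prod>i\<in>?H. 1 + of_nat (n\<^sup>2) * y i) 1 ?M" .
    show "denom_coprime ?M (\<Prod>i\<in>?H. 1 + of_nat (n\<^sup>2) * y i)"
      using y by (simp add: denom_coprime_prod del: of_nat_power)
  qed (simp add: denom_coprime_half_prod[OF assms])
  finally show ?thesis by simp
qed

text \<open>Up to signs, clearing denominators leaves the numerators \<open>n - i\<close> for
  parameter -2 and \<open>n - 2 * i\<close> for -1. The two splittings contribute one factor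
  \<open>2 ^ card (half_totatives n)\<close>, the denominators \<open>2 * i\<close> another;
  together they make \<open>2 ^ totient n\<close>.\<close>

lemma half_prod_minus_two:
  assumes "odd n" "n > 1"
  shows "half_prod n (- 2) = 2 ^ totient n * half_prod n (- 1)"
proof -
  let ?H = "half_totatives n"
  define Q :: rat where "Q = (\<Prod>i\<in>?H. of_nat i)"
  have Q: "Q \<noteq> 0" unfolding Q_def by (simp add: prod_zero_iff) (simp add: half_totatives_def)
  have "Q * (\<Prod>i\<in>?H. of_nat (n - i)) = (\<Prod>i\<in>?H. of_nat (2 * i)) * (\<Prod>i\<in>?H. of_nat (n - 2 * i))"
    using prod.totatives_half[OF assms(1), of "of_nat :: nat \<Rightarrow> rat"]
      prod.totatives_double[OF assms(1), of "of_nat :: nat \<Rightarrow> rat"]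
    unfolding Q_def prod.distrib[symmetric] by simp
  also have "(\<Prod>i\<in>?H. of_nat (2 * i)) = 2 ^ card ?H * Q"
    by (simp add: Q_def prod.distrib)
  finally have eq: "(\<Prod>i\<in>?H. of_nat (n - i)) = (2 ^ card ?H :: rat) * (\<Prod>i\<in>?H. of_nat (n - 2 * i))"
    using Q by auto
  have "half_prod n (- 2) * Q = (\<Prod>i\<in>?H. - of_nat (n - i))"
    unfolding half_prod_def Q_def prod.distrib[symmetric]
    by (intro prod.cong) (auto simp: half_totatives_def field_simps of_nat_diff)
  also have "\<dots> = (\<Prod>i\<in>?H. (- 1) * of_nat (n - i))" by simp
  also have "\<dots> = (- 1) ^ card ?H * (\<Prod>i\<in>?H. of_nat (n - i))"
    by (simp only: prod.distrib prod_constant)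
  also have "\<dots> = 2 ^ card ?H * ((- 1) ^ card ?H * (\<Prod>i\<in>?H. of_nat (n - 2 * i)))"
    by (simp add: eq)
  also have "(- 1) ^ card ?H * (\<Prod>i\<in>?H. of_nat (n - 2 * i)) = (\<Prod>i\<in>?H. (- 1) * of_nat (n - 2 * i) :: rat)"
    by (simp only: prod.distrib prod_constant)
  also have "\<dots> = (\<Prod>i\<in>?H. (1 + of_int (- 1) * of_nat n / (2 * of_nat i)) * (2 * of_nat i))"
    by (intro prod.cong) (auto simp: half_totatives_def field_simps of_nat_diff)
  also have "\<dots> = half_prod n (- 1) * (2 ^ card ?H * Q)"
    by (simp only: prod.distrib prod_constant half_prod_def Q_def)
  finally have "half_prod n (- 2) * Q = (2 ^ (card ?H + card ?H) * half_prod n (- 1)) * Q"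
    by (simp add: power_add mult_ac)
  then show ?thesis
    using Q by (simp add: totient_eq_card_half[OF assms] mult_2)
qed

lemma half_prod_cong:
  assumes "odd n" "n > 1"
  shows "rat_cong (half_prod n (int m)) ((1 / 2) ^ (m * totient n)) (cube_modulus n)"
proof -
  let ?F = "half_prod n" and ?t = "totient n" and ?M = "cube_modulus n"
  note integral = denom_coprime_half_prod[OF assms(1)]
  have half: "denom_coprime n (1 / 2)"
    using denom_coprime_inverse[of 2 n] assms by simp
  note cong = half_prod_add[OF assms(1)]
  have F0: "?F 0 = 1" by (simp add: half_prod_def)
  \<comment> \<open>Since \<open>?F (- 1) * ?F 1\<close> is congruent to \<open>?F 0 = 1\<close>,
    the exact identity for \<open>?F (- 2)\<close> gives \<open>?F (- 1) \<equiv> 2 ^ ?t\<close>;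
    multiplying by \<open>?F 1\<close> shows that \<open>?F 1\<close> inverts
    \<open>2 ^ ?t\<close>.\<close>
  have "rat_cong (?F (- 1)) (?F (- 2) * ?F 1) ?M"
    using cong[of "- 2" 1] by (simp add: rat_cong_sym)
  also have "?F (- 2) * ?F 1 = 2 ^ ?t * (?F (- 1) * ?F 1)"
    by (simp add: half_prod_minus_two[OF assms])
  also have "rat_cong (2 ^ ?t * (?F (- 1) * ?F 1)) (2 ^ ?t * 1) ?M"
    using cong[of "- 1" 1] integral by (intro rat_cong_mult) (simp_all add: F0)
  finally have "rat_cong (?F (- 1) * ?F 1) (2 ^ ?t * ?F 1) ?M"
    using integral by (intro rat_cong_mult) simp_all
  with cong[of "- 1" 1] have "rat_cong (2 ^ ?t * ?F 1) 1 ?M"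
    by (metis F0 add.left_inverse rat_cong_sym rat_cong_trans)
  then have "rat_cong ((1 / 2) ^ ?t * (2 ^ ?t * ?F 1)) ((1 / 2) ^ ?t * 1) ?M"
    using integral half by (intro rat_cong_mult) simp_all
  then have F1: "rat_cong (?F 1) ((1 / 2) ^ ?t) ?M"
    by (simp add: power_one_over)
  show ?thesis
  proof (induction m)
    case (Suc m)
    have "rat_cong (?F (int (Suc m))) (?F 1 * ?F (int m)) ?M"
      using cong[of 1 "int m"] by (simp add: rat_cong_sym)
    also have "rat_cong (?F 1 * ?F (int m)) ((1 / 2) ^ ?t * (1 / 2) ^ (m * ?t)) ?M"
      using F1 Suc integral half by (intro rat_cong_mult) simp_all
    finally show ?case by (simp add: power_add)
  qed (simp add: F0)
qed

section \<open>Moebius inversion\<close>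

lemma moebius_mu_prime_mult:
  assumes "prime p" "\<not> p dvd d" "d > 0"
  shows "moebius_mu (p * d) = - moebius_mu d"
proof -
  have "coprime p d" using assms prime_imp_coprime by blast
  then have "squarefree (p * d) \<longleftrightarrow> squarefree d"
    using assms by (auto intro: squarefree_mult_coprime squarefree_prime dest: squarefree_multD)
  moreover have "prime_factors (p * d) = insert p (prime_factors d)"
    using assms by (subst prime_factorization_mult) (auto simp: prime_factorization_prime)
  moreover have "p \<notin> prime_factors d" using assms by auto
  ultimately show ?thesis by (simp add: moebius_mu_def)
qed

text \<open>For a prime \<open>p\<close> dividing \<open>m\<close>, a divisor \<open>d\<close> prime
  to \<open>p\<close> cancels against \<open>p * d\<close>; all remaining divisors are divisible by
  \<open>p\<^sup>2\<close> and contribute 0.\<close>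

lemma sum_moebius_mu:
  assumes "m > 0"
  shows "(\<Sum>d | d dvd m. moebius_mu d) = (if m = 1 then 1 else 0)"
proof (cases "m = 1")
  case True
  then show ?thesis by (simp add: moebius_mu_def)
next
  case False
  then obtain p where p: "prime p" "p dvd m" using prime_factor_nat by blast
  let ?D = "{d. d dvd m \<and> \<not> p dvd d}" and ?E = "{d. d dvd m \<and> p dvd d}"
  have fin: "finite {d. d dvd m}" using assms by simp
  have pos: "d > 0" if "d dvd m" for d using that assms by (auto intro: Nat.gr0I)
  have "(\<Sum>d | d dvd m. moebius_mu d) = sum moebius_mu (?D \<union> ?E)"
    by (intro sum.cong) auto
  also have "\<dots> = sum moebius_mu ?D + sum moebius_mu ?E"
    using fin by (intro sum.union_disjoint) (auto intro: rev_finite_subset)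
  also have "sum moebius_mu ?E = sum moebius_mu ((*) p ` ?D)"
  proof (rule sum.mono_neutral_right)
    show "(*) p ` ?D \<subseteq> ?E"
      using p prime_imp_coprime by (auto intro!: divides_mult)
    show "\<forall>i\<in>?E - (*) p ` ?D. moebius_mu i = 0"
    proof
      fix i assume i: "i \<in> ?E - (*) p ` ?D"
      then obtain j where j: "i = p * j" by (auto elim: dvdE)
      with i have "p dvd j" by (auto dest: dvd_mult_right)
      with j have "p\<^sup>2 dvd i" by (simp add: power2_eq_square mult_dvd_mono)
      then have "\<not> squarefree i"
        using p(1) by (intro not_squarefreeI) (auto simp: prime_nat_iff)
      then show "moebius_mu i = 0" by (simp add: moebius_mu_def)
    qed
  qed (use fin in \<open>auto intro: rev_finite_subset\<close>)
  also have "\<dots> = (\<Sum>d\<in>?D. moebius_mu (p * d))"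
    using p(1) by (subst sum.reindex) (auto simp: inj_on_def)
  also have "\<dots> = (\<Sum>d\<in>?D. - moebius_mu d)"
    using p(1) pos by (intro sum.cong) (auto simp: moebius_mu_prime_mult)
  finally show ?thesis using False by (simp add: sum_negf)
qed

lemma prod_power_int:
  fixes f :: "'b \<Rightarrow> 'a :: field"
  shows "(\<Prod>i\<in>S. f i) powi k = (\<Prod>i\<in>S. f i powi k)"
  by (induction S rule: infinite_finite_induct) (simp_all add: power_int_mult_distrib)

lemma power_int_sum:
  fixes x :: "'a :: field"
  assumes "x \<noteq> 0"
  shows "x powi (\<Sum>i\<in>S. k i) = (\<Prod>i\<in>S. x powi k i)"
  using assms by (induction S rule: infinite_finite_induct) (simp_all add: power_int_add)

text \<open>After swapping the products, \<open>A e\<close> has as exponent the sum of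
  \<open>moebius_mu (n div d)\<close> over \<open>e dvd d\<close>, \<open>d dvd n\<close>, which is
  1 for \<open>e = n\<close> and 0 otherwise. Adding possibly negative exponents uses
  \<open>A e \<noteq> 0\<close>.\<close>

lemma moebius_inversion_prod:
  fixes A :: "nat \<Rightarrow> 'a :: field"
  assumes "n > 0" "\<And>e. e dvd n \<Longrightarrow> A e \<noteq> 0"
  shows "(\<Prod>d | d dvd n. (\<Prod>e | e dvd d. A e) powi moebius_mu (n div d)) = A n"
proof -
  let ?mu = "\<lambda>d. moebius_mu (n div d)"
  have fin: "finite {d. d dvd n}" using assms by simp
  have mu: "(\<Sum>d | d \<in> {d. d dvd n} \<and> e dvd d. ?mu d) = (if e = n then 1 else 0)"
    if e: "e dvd n" for e
  proof -
    obtain m where m: "n = e * m" using e by blast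
    with assms have pos: "e > 0" "m > 0" by auto
    \<comment> \<open>The complement \<open>d\<close> to \<open>n div d\<close> carries the divisors
      of \<open>n\<close> that are multiples of \<open>e\<close> onto the divisors of
      \<open>m = n div e\<close>.\<close>
    have "(\<Sum>d | d \<in> {d. d dvd n} \<and> e dvd d. ?mu d) = (\<Sum>c | c dvd m. moebius_mu c)"
      by (rule sum.reindex_bij_witness[of _ "\<lambda>c. n div c" "\<lambda>d. n div d"])
        (use pos m in \<open>auto elim!: dvdE\<close>)
    then show ?thesis using pos m by (auto simp: sum_moebius_mu)
  qed
  have "(\<Prod>d | d dvd n. (\<Prod>e | e dvd d. A e) powi ?mu d)
      = (\<Prod>d | d dvd n. \<Prod>e | e \<in> {e. e dvd n} \<and> e dvd d. A e powi ?mu d)"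
    unfolding prod_power_int by (intro prod.cong refl) (auto intro: dvd_trans)
  also have "\<dots> = (\<Prod>e | e dvd n. \<Prod>d | d \<in> {d. d dvd n} \<and> e dvd d. A e powi ?mu d)"
    by (rule prod.swap_restrict[OF fin fin])
  also have "\<dots> = (\<Prod>e | e dvd n. if e = n then A e else 1)"
  proof (intro prod.cong refl)
    fix e assume "e \<in> {e. e dvd n}"
    then have e: "e dvd n" by simp
    show "(\<Prod>d | d \<in> {d. d dvd n} \<and> e dvd d. A e powi ?mu d) = (if e = n then A e else 1)"
      unfolding power_int_sum[OF assms(2)[OF e], symmetric] mu[OF e] by simp
  qed
  also have "\<dots> = A n" using fin by (simp add: prod.delta)
  finally show ?thesis .
qed

section \<open>The binomial coefficients\<close>

text \<open>Each \<open>j\<close> below \<open>d / 2\<close> is reduced by \<open>gcd j d\<close> to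
  \<open>i\<close>, and \<open>d\<close> to \<open>e\<close>; the factor is unchanged because
  \<open>d / j = e / i\<close>.\<close>

lemma prod_half_prod:
  assumes "d > 0"
  shows "(\<Prod>e | e dvd d. half_prod e a)
    = (\<Prod>i | 0 < i \<and> 2 * i < d. 1 + of_int a * of_nat d / (2 * of_nat i))"
proof -
  have "(\<Prod>e | e dvd d. half_prod e a)
      = (\<Prod>(e, i)\<in>(SIGMA e:{e. e dvd d}. half_totatives e). 1 + of_int a * of_nat e / (2 * of_nat i))"
    using assms by (simp add: half_prod_def prod.Sigma)
  also have "\<dots> = (\<Prod>i | 0 < i \<and> 2 * i < d. 1 + of_int a * of_nat d / (2 * of_nat i))"
  proof (rule prod.reindex_bij_witness[of _ "\<lambda>j. (d div gcd j d, j div gcd j d)"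
        "\<lambda>(e, i). i * (d div e)"])
    fix x assume "x \<in> (SIGMA e:{e. e dvd d}. half_totatives e)"
    then obtain e i c where x: "x = (e, i)" "d = e * c" and i: "0 < i" "2 * i < e" "coprime i e"
      by (auto simp: half_totatives_def)
    then have pos: "e > 0" "c > 0" using assms by auto
    have g: "gcd (i * c) (e * c) = c"
      using i by (simp add: mult.commute flip: gcd_mult_distrib_nat)
    show "(\<lambda>j. (d div gcd j d, j div gcd j d)) (case x of (e, i) \<Rightarrow> i * (d div e)) = x"
      using x pos g by simp
    show "(case x of (e, i) \<Rightarrow> i * (d div e)) \<in> {i. 0 < i \<and> 2 * i < d}"
      using x pos i by simp
    show "1 + of_int a * of_nat d / (2 * of_nat (case x of (e, i) \<Rightarrow> i * (d div e)))
        = ((case x of (e, i) \<Rightarrow> 1 + of_int a * of_nat e / (2 * of_nat i)) :: rat)"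
      using x pos i by simp
  next
    fix j assume "j \<in> {i. 0 < i \<and> 2 * i < d}"
    then have j: "0 < j" "2 * j < d" by simp_all
    obtain u v where uv: "j = gcd j d * u" "d = gcd j d * v" "coprime u v"
      by (metis gcd_coprime_exists assms gcd_eq_0_iff less_numeral_extra(3) mult.commute)
    define g where "g = gcd j d"
    have g: "g > 0" "j = g * u" "d = g * v" using uv assms by (simp_all add: g_def)
    show "(case (d div gcd j d, j div gcd j d) of (e, i) \<Rightarrow> i * (d div e)) = j"
      unfolding g_def[symmetric] using g assms by auto
    show "(d div gcd j d, j div gcd j d) \<in> (SIGMA e:{e. e dvd d}. half_totatives e)"
      unfolding g_def[symmetric] using g j uv(3) by (auto simp: half_totatives_def)
  qed
  finally show ?thesis .
qed

lemma gbinomial_eq_prod_half_prod: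
  assumes "odd d"
  shows "((of_nat (k * d) - 1) / 2 :: rat) gchoose ((d - 1) div 2)
    = (\<Prod>e | e dvd d. half_prod e (int k - 1))"
proof -
  obtain h where h: "d = 2 * h + 1" using assms by (elim oddE)
  let ?x = "(of_nat (k * d) - 1) / 2 :: rat"
  \<comment> \<open>Reversing the index: \<open>?x - (h - i) = (k - 1) * d / 2 + i\<close>, because
    \<open>2 * h = d - 1\<close>.\<close>
  have "(\<Prod>i = 0..<h. ?x - of_nat i) = (\<Prod>i\<in>{1..h}. of_int (int k - 1) * of_nat d / 2 + of_nat i)"
    by (rule prod.reindex_bij_witness[of _ "\<lambda>i. h - i" "\<lambda>i. h - i"])
      (auto simp: h of_nat_diff field_simps)
  then have "?x gchoose h
      = (\<Prod>i\<in>{1..h}. of_int (int k - 1) * of_nat d / 2 + of_nat i) / (\<Prod>i\<in>{1..h}. of_nat i)"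
    by (simp add: gbinomial_prod_rev fact_prod)
  also have "\<dots> = (\<Prod>i\<in>{1..h}. 1 + of_int (int k - 1) * of_nat d / (2 * of_nat i))"
    unfolding prod_dividef[symmetric] by (intro prod.cong) (simp_all add: field_simps)
  also have "{1..h} = {i. 0 < i \<and> 2 * i < d}" by (auto simp: h)
  finally show ?thesis by (simp add: prod_half_prod h)
qed

text \<open>Supplies the nonvanishing that Moebius inversion asks for.\<close>

lemma half_prod_pos: "a \<ge> 0 \<Longrightarrow> half_prod n a > 0"
  unfolding half_prod_def by (intro prod_pos) (auto intro!: add_pos_nonneg)

theorem theorem4:
  fixes k n :: nat
  assumes "k > 0" and "n > 1" and "odd n"
  shows "rat_cong
    (\<Prod>d | d dvd n.
       (((of_nat (k * d) - 1) / 2 :: rat) gchoose ((d - 1) div 2)) powi moebius_mu (n div d))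
    (2 powi (- ((int k - 1) * int (totient n))))
    (if 3 dvd n then n ^ 3 div 3 else n ^ 3)"
proof -
  have "(\<Prod>d | d dvd n.
       (((of_nat (k * d) - 1) / 2 :: rat) gchoose ((d - 1) div 2)) powi moebius_mu (n div d))
     = (\<Prod>d | d dvd n. (\<Prod>e | e dvd d. half_prod e (int k - 1)) powi moebius_mu (n div d))"
  proof (intro prod.cong refl)
    fix d assume "d \<in> {d. d dvd n}"
    then have "odd d" using assms(3) dvd_trans by blast
    then show "(((of_nat (k * d) - 1) / 2 :: rat) gchoose ((d - 1) div 2)) powi moebius_mu (n div d)
        = (\<Prod>e | e dvd d. half_prod e (int k - 1)) powi moebius_mu (n div d)"
      by (simp only: gbinomial_eq_prod_half_prod not_False_eq_True)
  qed
  \<comment> \<open>Here \<open>k > 0\<close> makes the parameter \<open>int k - 1\<close>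
    nonnegative and equal to the truncated difference \<open>k - 1\<close>.\<close>
  also have "\<dots> = half_prod n (int (k - 1))"
    using assms half_prod_pos[of "int k - 1"]
    by (subst moebius_inversion_prod) (auto simp: of_nat_diff less_imp_neq[symmetric])
  finally have lhs: "(\<Prod>d | d dvd n.
       (((of_nat (k * d) - 1) / 2 :: rat) gchoose ((d - 1) div 2)) powi moebius_mu (n div d))
     = half_prod n (int (k - 1))" .
  have "(int k - 1) * int (totient n) = int ((k - 1) * totient n)"
    using assms(1) by (simp add: of_nat_diff)
  then have rhs: "2 powi (- ((int k - 1) * int (totient n))) = ((1 / 2) ^ ((k - 1) * totient n) :: rat)"
    by (simp only: power_int_minus power_int_of_nat) (simp add: power_one_over inverse_eq_divide)
  show ?thesis
    unfolding lhs rhs using half_prod_cong[OF assms(3,2), of "k - 1"] by (simp add: cube_modulus_def)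
qed

end
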